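(* Let $\mathcal{C}$ be any $f$-separable hereditary class, where $f:\mathbb{N}_+\to\mathbb{N}_+$, and let $$C_f(n)=f(n)+\sum_{i=0}^{\ell(n)} f\Big(\Big\lfloor\Big(\tfrac23\Big)^i n\Big\rfloor\Big),\qquad \ell(n)=\lceil\log_{3/2}n\rceil+1.$$ Then for any $n$-vertex $G\in\mathcal{C}$, the STT algorithm uses $C_f(n)$ cops, and thus $\mathsf{cop}_0(G)\le C_f(n)$.
   Context: Zero-visibility Cops and Robbers on $G$: $k$ cops choose starting vertices, then the robber; in each round each cop stays or moves to a neighbour, then the robber does likewise; the robber sees the cops but the cops never know the robber's position; the cops win if a cop occupies the robber's vertex. $\mathsf{cop}_0(G)$ is the minimum $k$ for which the cops can guarantee capture. A set $S\subset V$ is an $(s,\alpha)$-separator of $G=(V,E)$ if $V=A\cup B\cup S$ with $A,B,S$ pairwise disjoint, $|S|\le s$, $|A|,|B|\le\alpha|V|$ and no edge joins $A$ and $B$. The separation number $\mathrm{s}(G)$ is the least $s$ such that every subgraph of $G$ has an $(s,2/3)$-separator. $\mathcal{C}$ is $f$-separable if every $n$-vertex $G\in\mathcal{C}$ has $\mathrm{s}(G)\le f(n)$; hereditary means closed under induced subgraphs. STT uses a separation algorithm $\mathcal{S}$ returning, for a graph $H$ in $\mathcal{C}$ with $m$ vertices, a partition $(A,B,C)$ of $V(H)$ with $C$ an $(f(m),2/3)$-separator and separated sets $A,B$. STT on an $n$-vertex $G$: it keeps Stack-B of pairs (vertex set, binary string index) and Stack-C of pairs (separator, index). Scheduler: push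 $(V(G),\varepsilon)$ on Stack-B, Stack-C empty. While Stack-B is nonempty: pop $(U,w)$; let $p$ be $w$ without its last character; if Stack-C is nonempty then, while $p$ differs from the index of the top of Stack-C, pop $(S,w')$ from Stack-C and remove the cops from $S$; then call Separate$(G[U],w,n)$. Separate$(H,w,n)$: if $|V(H)|\le f(n)$, place cops on all vertices of $H$ and then remove them; otherwise compute $(A,B,C)=\mathcal{S}(H)$, place cops on all vertices of $C$, push $(C,w)$ onto Stack-C, then push $(B,w\cdot0)$ and $(A,w\cdot1)$ onto Stack-B. When cops must move along edges, each placement is realised by walking cops to the target vertices. The number of cops used is the number of cops needed to carry out all placements.
   Formalization: The bound on cop_0 is stated for connected G (it fails for edgeless graphs); the STT bound is stated for nondecreasing f with any S, or any f with S returning separators of size at most s(H), since it fails for non-monotone f with arbitrary S. *)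

theory Defs
  imports Complex_Main "HOL-Library.Multiset" "HOL-Library.Extended_Nat"
    "Graph_Theory.Graph_Theory"
begin

text \<open>
  A finite simple graph is a value \<open>G\<close> with \<open>pair_graph G\<close>: a finite, loop-free digraph with
  symmetric arc relation, an edge being a pair of opposite arcs.  Library notions on
  \<open>pre_digraph\<close> apply through the coercion \<open>with_proj\<close>.
\<close>

section \<open>Zero-visibility Cops and Robber\<close>

definition lazy_walk :: "'a pair_pre_digraph \<Rightarrow> (nat \<Rightarrow> 'a) \<Rightarrow> bool" where
  "lazy_walk G w \<longleftrightarrow>
     (\<forall>t. w t \<in> pverts G \<and> (w (Suc t) = w t \<or> (w t, w (Suc t)) \<in> parcs G))"

text \<open>
  The cops receive no information, so a strategy for them is a schedule \<open>c\<close> fixed in advance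
  (\<open>c i t\<close> is the position of cop \<open>i\<close> after round \<open>t\<close>).  The robber sees the cops, so against a
  given schedule every lazy walk \<open>r\<close> is available to him.  In round \<open>Suc t\<close> the cops move first,
  while the robber is still at \<open>r t\<close>; hence the second way of being caught.
\<close>

definition cops_win :: "'a pair_pre_digraph \<Rightarrow> nat \<Rightarrow> bool" where
  "cops_win G k \<longleftrightarrow>
     (\<exists>c :: nat \<Rightarrow> nat \<Rightarrow> 'a. (\<forall>i<k. lazy_walk G (c i)) \<and>
       (\<forall>r. lazy_walk G r \<longrightarrow> (\<exists>t. \<exists>i<k. c i t = r t \<or> c i (Suc t) = r t)))"

definition cop0 :: "'a pair_pre_digraph \<Rightarrow> nat" where
  "cop0 G = (LEAST k. cops_win G k)"


section \<open>Separators\<close>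

definition separation ::
  "'a pair_pre_digraph \<Rightarrow> nat \<Rightarrow> real \<Rightarrow> 'a set \<Rightarrow> 'a set \<Rightarrow> 'a set \<Rightarrow> bool" where
  "separation G s \<alpha> A B X \<longleftrightarrow>
     pverts G = A \<union> B \<union> X \<and> A \<inter> B = {} \<and> A \<inter> X = {} \<and> B \<inter> X = {} \<and>
     card X \<le> s \<and>
     real (card A) \<le> \<alpha> * real (card (pverts G)) \<and>
     real (card B) \<le> \<alpha> * real (card (pverts G)) \<and>
     (\<forall>a\<in>A. \<forall>b\<in>B. (a, b) \<notin> parcs G \<and> (b, a) \<notin> parcs G)"

definition is_separator :: "'a pair_pre_digraph \<Rightarrow> nat \<Rightarrow> real \<Rightarrow> 'a set \<Rightarrow> bool" where
  "is_separator G s \<alpha> X \<longleftrightarrow> (\<exists>A B. separation G s \<alpha> A B X)"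

text \<open>The condition \<open>pair_graph H\<close> restricts to undirected subgraphs.\<close>

definition separation_number :: "'a pair_pre_digraph \<Rightarrow> nat" where
  "separation_number G =
     (LEAST s. \<forall>H. pair_graph H \<and> subgraph (with_proj H) (with_proj G)
                 \<longrightarrow> (\<exists>X. is_separator H s (2/3) X))"

definition separable :: "(nat \<Rightarrow> nat) \<Rightarrow> 'a pair_pre_digraph set \<Rightarrow> bool" where
  "separable f \<C> \<longleftrightarrow> (\<forall>G\<in>\<C>. separation_number G \<le> f (card (pverts G)))"

text \<open>The null graph may, but need not, belong to a hereditary class.\<close>

definition hereditary :: "'a pair_pre_digraph set \<Rightarrow> bool" where
  "hereditary \<C> \<longleftrightarrow>
     (\<forall>G\<in>\<C>. \<forall>H. induced_subgraph (with_proj H) (with_proj G) \<and> pverts H \<noteq> {} \<longrightarrow> H \<in> \<C>)"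

text \<open>
  On \<open>H\<close> the algorithm returns \<open>(A, B, X)\<close>, where \<open>X\<close> is a \<open>(b H, 2/3)\<close>-separator with
  separated sides \<open>A\<close> and \<open>B\<close>.
\<close>

definition separation_algorithm ::
  "('a pair_pre_digraph \<Rightarrow> nat) \<Rightarrow> 'a pair_pre_digraph set \<Rightarrow>
   ('a pair_pre_digraph \<Rightarrow> 'a set \<times> 'a set \<times> 'a set) \<Rightarrow> bool" where
  "separation_algorithm b \<C> S \<longleftrightarrow>
     (\<forall>H\<in>\<C>. pverts H \<noteq> {} \<longrightarrow>
        (case S H of (A, B, X) \<Rightarrow> separation H (b H) (2/3) A B X))"


section \<open>The STT algorithm\<close>

definition induce :: "'a pair_pre_digraph \<Rightarrow> 'a set \<Rightarrow> 'a pair_pre_digraph" where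
  "induce G U = \<lparr> pverts = U, parcs = parcs G \<inter> U \<times> U \<rparr>"

text \<open>
  The program counter: \<open>Fetch\<close> is the head of the scheduler loop, \<open>Unwind U w\<close> the inner loop
  that pops Stack-C, \<open>Separate U w\<close> the call on \<open>G[U]\<close>, and \<open>Sweep U\<close> the moment in a call with
  few vertices when cops stand on all of \<open>U\<close> and are about to be removed.
\<close>

datatype 'a stt_pc =
    Fetch
  | Unwind "'a set" "bool list"
  | Separate "'a set" "bool list"
  | Sweep "'a set"

text \<open>
  A configuration is (program counter, Stack-B, Stack-C, multiset of cop positions); the head of
  a list is the top of the stack.  The index character 1 is \<open>True\<close> and 0 is \<open>False\<close>.
\<close>

type_synonym 'a stt_config =
  "'a stt_pc \<times> ('a set \<times> bool list) list \<times> ('a set \<times> bool list) list \<times> 'a multiset"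

inductive stt_step ::
  "('a pair_pre_digraph \<Rightarrow> 'a set \<times> 'a set \<times> 'a set) \<Rightarrow> (nat \<Rightarrow> nat) \<Rightarrow>
   'a pair_pre_digraph \<Rightarrow> 'a stt_config \<Rightarrow> 'a stt_config \<Rightarrow> bool"
  for S f G where
  pop_B: "stt_step S f G (Fetch, (U, w) # bs, cs, P) (Unwind U w, bs, cs, P)"
| pop_C: "w' \<noteq> butlast w \<Longrightarrow>
    stt_step S f G (Unwind U w, bs, (X, w') # cs, P) (Unwind U w, bs, cs, P - mset_set X)"
| call: "cs = [] \<or> snd (hd cs) = butlast w \<Longrightarrow>
    stt_step S f G (Unwind U w, bs, cs, P) (Separate U w, bs, cs, P)"
| place_all: "card U \<le> f (card (pverts G)) \<Longrightarrow>
    stt_step S f G (Separate U w, bs, cs, P) (Sweep U, bs, cs, P + mset_set U)"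
| remove_all:
    "stt_step S f G (Sweep U, bs, cs, P) (Fetch, bs, cs, P - mset_set U)"
| split: "f (card (pverts G)) < card U \<Longrightarrow> S (induce G U) = (A, B, X) \<Longrightarrow>
    stt_step S f G (Separate U w, bs, cs, P)
      (Fetch, (A, w @ [True]) # (B, w @ [False]) # bs, (X, w) # cs, P + mset_set X)"

definition stt_init :: "'a pair_pre_digraph \<Rightarrow> 'a stt_config" where
  "stt_init G = (Fetch, [(pverts G, [])], [], {#})"

text \<open>
  The number of cops needed to carry out all placements is the largest number of cops placed
  simultaneously during the run.  It is an \<open>enat\<close> so that an unbounded run would count as
  \<open>\<infinity>\<close>.
\<close>

definition stt_cops ::
  "('a pair_pre_digraph \<Rightarrow> 'a set \<times> 'a set \<times> 'a set) \<Rightarrow> (nat \<Rightarrow> nat) \<Rightarrow>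
   'a pair_pre_digraph \<Rightarrow> enat" where
  "stt_cops S f G =
     (SUP (pc, bs, cs, P) \<in> {\<sigma>. (stt_step S f G)\<^sup>*\<^sup>* (stt_init G) \<sigma>}. enat (size P))"


section \<open>The bound\<close>

definition ell :: "nat \<Rightarrow> nat" where
  "ell n = nat \<lceil>log (3/2) (real n)\<rceil> + 1"

text \<open>
  For \<open>n \<ge> 1\<close> the last argument of \<open>f\<close> below is \<open>0\<close> (and possibly the one before it), which is
  outside the domain of a function on positive integers.  No assumption is made on \<open>f 0\<close>, so
  the bound includes the case \<open>f 0 = 0\<close>, in which these terms vanish.
\<close>

definition C_bound :: "(nat \<Rightarrow> nat) \<Rightarrow> nat \<Rightarrow> nat" where
  "C_bound f n = f n + (\<Sum>i=0..ell n. f (nat \<lfloor>(2/3) ^ i * real n\<rfloor>))"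

end

theory Submission
  imports Defs
begin

text \<open>
  A set at recursion depth \<open>d\<close> has at most \<open>(2/3)^d n\<close> vertices, so its separator has at most
  \<open>f \<lfloor>(2/3)^d n\<rfloor>\<close> of them.  The cops standing at any time occupy one separator for each
  depth and at most one small set of \<open>f n\<close> vertices.  For \<open>cop0\<close>, the same recursion is played
  with walking cops: the separators placed so far guard the current set, so a robber outside
  cannot enter it, and clearing both sides of a separator guarded in this way clears the set,
  wherever the other cops have to walk in the meantime.
\<close>

abbreviation level_cops :: "(nat \<Rightarrow> nat) \<Rightarrow> nat \<Rightarrow> nat \<Rightarrow> nat" where
  "level_cops f n d \<equiv> f (nat \<lfloor>(2/3) ^ d * real n\<rfloor>)"

section \<open>Separation numbers\<close>

lemma pverts_induce [simp]: "pverts (induce G U) = U"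
  by (simp add: induce_def)

lemma parcs_induce [simp]: "parcs (induce G U) = parcs G \<inter> U \<times> U"
  by (simp add: induce_def)

lemma pair_graph_induce:
  assumes "pair_graph G" "U \<subseteq> pverts G"
  shows "pair_graph (induce G U)"
proof -
  interpret pair_graph G by fact
  have "sym (parcs G)"
    by (auto intro: symI arcs_symmetric)
  then show ?thesis
    using pair_finite_verts pair_finite_arcs no_loops' assms(2)
    by unfold_locales (auto simp: symmetric_def sym_def intro: finite_subset)
qed

lemma subgraph_induce:
  assumes "pair_graph G" "U \<subseteq> W" "W \<subseteq> pverts G"
  shows "subgraph (with_proj (induce G U)) (with_proj (induce G W))"
proof -
  interpret U: pair_graph "induce G U"
    by (rule pair_graph_induce) (use assms in auto)
  interpret W: pair_graph "induce G W"
    by (rule pair_graph_induce) (use assms in auto)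
  show ?thesis
    using assms U.wf_digraph W.wf_digraph
    by (auto simp: subgraph_def compatible_def)
qed

lemma hereditary_induce:
  assumes "hereditary \<C>" "G \<in> \<C>" "pair_graph G" "U \<subseteq> pverts G" "U \<noteq> {}"
  shows "induce G U \<in> \<C>"
proof -
  interpret G: pair_graph G by fact
  \<comment> \<open>Arcs have both ends in \<open>pverts G\<close>, so
    \<open>subgraph_induce\<close> with \<open>W = pverts G\<close> compares
    \<open>induce G U\<close> with \<open>G\<close> itself.\<close>
  have "induce G (pverts G) = G"
    by (rule pair_pre_digraph.equality) (auto dest: G.in_arcsD1 G.in_arcsD2)
  then have "subgraph (with_proj (induce G U)) (with_proj G)"
    using subgraph_induce[OF assms(3,4)] by simp
  then have "induced_subgraph (with_proj (induce G U)) (with_proj G)"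
    by (auto simp: induced_subgraph_def)
  then show ?thesis
    using assms by (auto simp: hereditary_def)
qed

lemma separation_mono:
  "separation G s \<alpha> A B X \<Longrightarrow> s \<le> t \<Longrightarrow> separation G t \<alpha> A B X"
  by (auto simp: separation_def)

text \<open>The \<open>LEAST\<close> has its defining property because some value has it: the full
  vertex set of a subgraph is a separator with two empty sides, so \<open>card (pverts G)\<close>
  qualifies.\<close>

lemma separator_le_separation_number:
  assumes "finite (pverts G)" "pair_graph H" "subgraph (with_proj H) (with_proj G)"
  shows "\<exists>X. is_separator H (separation_number G) (2/3) X"
proof -
  have "is_separator H' (card (pverts G)) (2/3) (pverts H')"
    if "subgraph (with_proj H') (with_proj G)" for H'
    using that assms(1)
    by (auto simp: is_separator_def separation_def subgraph_def card_mono intro!: exI[of _ "{}"])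
  then have "\<forall>H. pair_graph H \<and> subgraph (with_proj H) (with_proj G)
                 \<longrightarrow> (\<exists>X. is_separator H (card (pverts G)) (2/3) X)"
    by blast
  from LeastI[of "\<lambda>s. \<forall>H. pair_graph H \<and> subgraph (with_proj H) (with_proj G)
                 \<longrightarrow> (\<exists>X. is_separator H s (2/3) X)", OF this]
  show ?thesis
    using assms unfolding separation_number_def by blast
qed

text \<open>Subgraphs of \<open>H\<close> are subgraphs of \<open>G\<close>, so the value for
  \<open>G\<close> is a candidate in the minimum for \<open>H\<close>.\<close>

lemma separation_number_mono:
  assumes "finite (pverts G)" "subgraph (with_proj H) (with_proj G)"
  shows "separation_number H \<le> separation_number G"
  unfolding separation_number_def[of H]
  by (intro Least_le allI impI separator_le_separation_number[OF assms(1)])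
    (use assms(2) subgraph_trans in blast)+

lemma exists_separation:
  assumes "pair_graph H"
  shows "\<exists>A B X. separation H (separation_number H) (2/3) A B X"
proof -
  interpret pair_graph H by fact
  have "subgraph (with_proj H) (with_proj H)"
    using wf_digraph by (auto simp: subgraph_def compatible_def)
  from separator_le_separation_number[OF pair_finite_verts assms this]
  show ?thesis
    by (auto simp: is_separator_def)
qed

text \<open>
  No monotonicity of \<open>f\<close> is needed: \<open>U\<close> is enlarged to a set with exactly as many vertices as
  the argument of \<open>f\<close>, and it is the separation number that is monotone.
\<close>

lemma separation_number_level:
  assumes C: "hereditary \<C>" "separable f \<C>" "G \<in> \<C>" "pair_graph G"
    and U: "U \<subseteq> pverts G" "U \<noteq> {}" "real (card U) \<le> (2/3) ^ d * real (card (pverts G))"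
  shows "separation_number (induce G U) \<le> level_cops f (card (pverts G)) d"
proof -
  interpret pair_graph G by fact
  define m where "m = nat \<lfloor>(2/3) ^ d * real (card (pverts G))\<rfloor>"
  have fin: "finite U"
    using U(1) pair_finite_verts by (rule finite_subset)
  have "card U \<le> m"
    unfolding m_def using U(3) by (simp add: le_nat_floor)
  \<comment> \<open>Hence \<open>m\<close> is at most the number of vertices of \<open>G\<close>,
    which leaves room for a superset of \<open>U\<close> with exactly \<open>m\<close>
    vertices.\<close>
  moreover have "(2/3) ^ d * real (card (pverts G)) \<le> 1 * real (card (pverts G))"
    by (intro mult_right_mono power_le_one) auto
  then have "m \<le> card (pverts G)"
    unfolding m_def by linarith
  ultimately obtain W where W: "U \<subseteq> W" "W \<subseteq> pverts G" "card W = m"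
    using exists_subset_between[of U m "pverts G"] U(1) pair_finite_verts by auto
  have "separation_number (induce G U) \<le> separation_number (induce G W)"
    using W pair_finite_verts C(4)
    by (intro separation_number_mono subgraph_induce) (auto intro: finite_subset)
  also have "induce G W \<in> \<C>"
    using W U by (intro hereditary_induce C) auto
  then have "separation_number (induce G W) \<le> f m"
    using C(2) W(3) by (auto simp: separable_def)
  finally show ?thesis
    by (simp add: m_def)
qed

text \<open>The assumption gives \<open>(3/2) ^ d * 2 \<le> n\<close>, and already
  \<open>(3/2) ^ d \<le> n\<close> bounds \<open>d\<close> by the logarithm. So a set of two or more
  vertices never lies at a depth beyond the last summand of \<open>C_bound\<close>.\<close>

lemma depth_le_ell:
  assumes "2 \<le> (2/3) ^ d * real n"
  shows "d \<le> ell n"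
proof -
  have "n \<noteq> 0"
    using assms by (cases n) auto
  have "(3/2) ^ d * 2 \<le> (3/2) ^ d * ((2/3) ^ d * real n)"
    using assms by (intro mult_left_mono) auto
  also have "\<dots> = real n"
    by (simp add: power_divide)
  finally have "(3/2) ^ d * 2 \<le> real n" .
  moreover have "0 \<le> (3/2 :: real) ^ d"
    by simp
  ultimately have "(3/2) ^ d \<le> real n"
    by linarith
  then have "log (3/2) ((3/2) ^ d) \<le> log (3/2) (real n)"
    using \<open>n \<noteq> 0\<close> by (subst log_le_cancel_iff) auto
  then have "real d \<le> log (3/2) (real n)"
    by (simp add: log_nat_power)
  then show ?thesis
    unfolding ell_def by linarith
qed

lemma separation_sides:
  assumes "separation (induce G U) s (2/3) A B X" "real (card U) \<le> (2/3) ^ d * real n"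
  shows "real (card A) \<le> (2/3) ^ Suc d * real n" "real (card B) \<le> (2/3) ^ Suc d * real n"
  using assms by (auto simp: separation_def)

section \<open>The number of cops of an STT run\<close>

definition stack_C_inv where
  "stack_C_inv f G cs \<longleftrightarrow>
     sorted_wrt (\<lambda>x y. length (snd y) < length (snd x)) cs \<and>
     (\<forall>(X, w)\<in>set cs. card X \<le> level_cops f (card (pverts G)) (length w) \<and>
        length w \<le> ell (card (pverts G)))"

definition stack_B_ok where
  "stack_B_ok G U w \<longleftrightarrow>
     U \<subseteq> pverts G \<and> real (card U) \<le> (2/3) ^ length w * real (card (pverts G))"

definition stack_cops :: "('a set \<times> bool list) list \<Rightarrow> 'a multiset" where
  "stack_cops cs = sum_list (map (\<lambda>x. mset_set (fst x)) cs)"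

text \<open>
  Every separator on Stack-C has its own recursion depth, since the indices on the stack get
  strictly longer towards its top.  For a push this follows from the top index being
  \<open>butlast w\<close>, provided that \<open>w\<close> is not empty; the empty index occurs only at the first call.
\<close>

fun stt_inv where
  "stt_inv f G (pc, bs, cs, P) \<longleftrightarrow>
     stack_C_inv f G cs \<and> (\<forall>(U, w)\<in>set bs. stack_B_ok G U w) \<and>
     (case pc of
        Fetch \<Rightarrow> P = stack_cops cs \<and> (cs = [] \<and> bs = [(pverts G, [])] \<or> (\<forall>(U, w)\<in>set bs. w \<noteq> []))
      | Unwind U w \<Rightarrow> P = stack_cops cs \<and> (\<forall>(U, w)\<in>set bs. w \<noteq> []) \<and> stack_B_ok G U w \<and>
          (w = [] \<longrightarrow> cs = [])
      | Separate U w \<Rightarrow> P = stack_cops cs \<and> (\<forall>(U, w)\<in>set bs. w \<noteq> []) \<and> stack_B_ok G U w \<and>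
          (w = [] \<longrightarrow> cs = []) \<and> (cs = [] \<or> snd (hd cs) = butlast w)
      | Sweep U \<Rightarrow> P = stack_cops cs + mset_set U \<and> (\<forall>(U, w)\<in>set bs. w \<noteq> []) \<and>
          card U \<le> f (card (pverts G)))"

text \<open>The index lengths on Stack-C are pairwise distinct and at most \<open>ell\<close>, so
  the separators can be charged to different summands.\<close>

lemma size_stack_cops:
  assumes "stack_C_inv f G cs"
  shows "size (stack_cops cs) \<le> (\<Sum>i=0..ell (card (pverts G)). level_cops f (card (pverts G)) i)"
proof -
  let ?g = "level_cops f (card (pverts G))" and ?ls = "map (\<lambda>x. length (snd x)) cs"
  have "size (stack_cops cs) = (\<Sum>x\<leftarrow>cs. card (fst x))"
    unfolding stack_cops_def by (induction cs) auto
  also have "\<dots> \<le> (\<Sum>x\<leftarrow>cs. ?g (length (snd x)))"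
    using assms by (intro sum_list_mono) (auto simp: stack_C_inv_def)
  also have "\<dots> = sum_list (map ?g ?ls)"
    by (simp add: comp_def)
  also have "\<dots> = sum ?g (set ?ls)"
  proof (rule sum_list_distinct_conv_sum_set)
    have "sorted_wrt (>) ?ls"
      using assms by (simp add: stack_C_inv_def sorted_wrt_map)
    then show "distinct ?ls"
      by (induction ?ls) (auto simp: strict_sorted_iff sorted_wrt_iff_nth_less distinct_conv_nth
          linorder_neq_iff)
  qed
  also have "\<dots> \<le> sum ?g {0..ell (card (pverts G))}"
    using assms by (intro sum_mono2) (auto simp: stack_C_inv_def)
  finally show ?thesis .
qed

text \<open>Only \<open>split\<close> carries content. The assumption on \<open>S\<close> bounds a
  separator by the depth of its set instead of by its cardinality; both kinds of algorithm in the
  final theorem are shown to satisfy it.\<close>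

lemma stt_step_inv:
  assumes "stt_step S f G \<sigma> \<tau>" "stt_inv f G \<sigma>"
    and pos: "f (card (pverts G)) \<ge> 1"
    and sep: "\<And>U d A B X. U \<subseteq> pverts G \<Longrightarrow> U \<noteq> {} \<Longrightarrow>
      real (card U) \<le> (2/3) ^ d * real (card (pverts G)) \<Longrightarrow> S (induce G U) = (A, B, X) \<Longrightarrow>
      separation (induce G U) (level_cops f (card (pverts G)) d) (2/3) A B X"
  shows "stt_inv f G \<tau>"
  using assms(1,2)
proof cases
  case (split U A B X w bs cs P)
  from split assms(2) have U: "U \<subseteq> pverts G" "real (card U) \<le> (2/3) ^ length w * real (card (pverts G))"
    and C: "stack_C_inv f G cs" "w = [] \<longrightarrow> cs = []" "cs = [] \<or> snd (hd cs) = butlast w"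
    by (auto simp: stack_B_ok_def)
  \<comment> \<open>A split happens only above \<open>f n \<ge> 1\<close> vertices; the resulting
    two vertices are what \<open>depth_le_ell\<close> asks for.\<close>
  have "card U \<ge> 2" "U \<noteq> {}"
    using split pos by auto
  then have sep: "separation (induce G U) (level_cops f (card (pverts G)) (length w)) (2/3) A B X"
    using sep U split by blast
  have "length w \<le> ell (card (pverts G))"
    using \<open>card U \<ge> 2\<close> U(2) by (intro depth_le_ell) linarith
  moreover have "length (snd x) < length w" if "x \<in> set cs" for x
    using that C by (cases cs) (fastforce simp: stack_C_inv_def)+
  ultimately have "stack_C_inv f G ((X, w) # cs)"
    using C(1) sep by (auto simp: stack_C_inv_def separation_def)
  moreover have "A \<subseteq> pverts G" "B \<subseteq> pverts G"
    using sep U(1) by (auto simp: separation_def)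
  ultimately show ?thesis
    using separation_sides[OF sep U(2)] split assms(2)
    by (auto simp: stack_B_ok_def stack_cops_def)
\<comment> \<open>In \<open>pop_C\<close> and \<open>remove_all\<close> the subtracted multiset is a
  summand of \<open>P\<close> by the invariant, so the difference is exact.\<close>
qed (auto simp: stack_C_inv_def stack_cops_def)

lemma stt_cops_le:
  assumes pos: "f (card (pverts G)) \<ge> 1"
    and sep: "\<And>U d A B X. U \<subseteq> pverts G \<Longrightarrow> U \<noteq> {} \<Longrightarrow>
      real (card U) \<le> (2/3) ^ d * real (card (pverts G)) \<Longrightarrow> S (induce G U) = (A, B, X) \<Longrightarrow>
      separation (induce G U) (level_cops f (card (pverts G)) d) (2/3) A B X"
  shows "stt_cops S f G \<le> enat (C_bound f (card (pverts G)))"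
  unfolding stt_cops_def
proof (rule SUP_least, clarsimp)
  fix pc bs cs P
  assume "(stt_step S f G)\<^sup>*\<^sup>* (stt_init G) (pc, bs, cs, P)"
  then have "stt_inv f G (pc, bs, cs, P)"
  proof (induction rule: rtranclp_induct)
    case base
    show ?case
      by (simp add: stt_init_def stack_C_inv_def stack_B_ok_def stack_cops_def)
  next
    case (step \<sigma> \<tau>)
    then show ?case
      using stt_step_inv[OF _ _ pos sep] by blast
  qed
  \<comment> \<open>The first summand of \<open>C_bound\<close> pays for the small set occupied
    during \<open>Sweep\<close>.\<close>
  moreover from this have "size (stack_cops cs) + f (card (pverts G)) \<le> C_bound f (card (pverts G))"
    using size_stack_cops[of f G cs] by (simp add: C_bound_def)
  ultimately show "size P \<le> C_bound f (card (pverts G))"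
    by (cases pc) auto
qed

section \<open>Clearing a graph with walking cops\<close>

text \<open>
  States of the game are pairs of the cop positions and the set of vertices where an uncaught
  robber may be.  In \<open>cop_step G K j\<close> the first \<open>j\<close> of the \<open>K\<close> cops do not move.
\<close>

definition escape where
  "escape G K p p' Q =
     {v'. \<exists>v\<in>Q. v \<notin> p ` {..<K} \<and> v \<notin> p' ` {..<K} \<and> (v' = v \<or> (v, v') \<in> parcs G)}"

definition cop_step ::
  "'a pair_pre_digraph \<Rightarrow> nat \<Rightarrow> nat \<Rightarrow> (nat \<Rightarrow> 'a) \<times> 'a set \<Rightarrow> (nat \<Rightarrow> 'a) \<times> 'a set \<Rightarrow> bool"
where
  "cop_step G K j x y \<longleftrightarrow>
     (\<forall>i<j. fst y i = fst x i) \<and>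
     (\<forall>i<K. fst y i = fst x i \<or> (fst x i, fst y i) \<in> parcs G) \<and>
     snd y = escape G K (fst x) (fst y) (snd x)"

text \<open>The guards are the first \<open>j\<close> cops because these are frozen in
  \<open>cop_step G K j\<close>; the property therefore survives all such steps.\<close>

definition guarded where
  "guarded G p j W \<longleftrightarrow> (\<forall>v u. (v, u) \<in> parcs G \<longrightarrow> u \<in> W \<longrightarrow> v \<in> W \<union> p ` {..<j})"

lemma cop_steps_guards:
  "(cop_step G K j)\<^sup>*\<^sup>* x y \<Longrightarrow> i < j \<Longrightarrow> fst y i = fst x i"
  by (induction rule: rtranclp_induct) (auto simp: cop_step_def)

lemma cop_steps_guard_set:
  "(cop_step G K j)\<^sup>*\<^sup>* x y \<Longrightarrow> fst y ` {..<j} = fst x ` {..<j}"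
  using cop_steps_guards[of G K j x y] by (auto simp: image_iff)

lemma guarded_cong:
  "p ` {..<j} = p' ` {..<j} \<Longrightarrow> guarded G p j W \<longleftrightarrow> guarded G p' j W"
  by (simp add: guarded_def)

lemma cop_steps_mono:
  "(cop_step G K j')\<^sup>*\<^sup>* x y \<Longrightarrow> j \<le> j' \<Longrightarrow> (cop_step G K j)\<^sup>*\<^sup>* x y"
  by (erule mono_rtranclp[rule_format, rotated]) (auto simp: cop_step_def)

lemma cop_steps_valid:
  assumes "(cop_step G K j)\<^sup>*\<^sup>* x y" "pair_graph G" "\<forall>i<K. fst x i \<in> pverts G"
  shows "\<forall>i<K. fst y i \<in> pverts G"
proof -
  interpret pair_graph G by fact
  show ?thesis
    using assms(1,3)
    by (induction rule: rtranclp_induct) (auto simp: cop_step_def, metis in_arcsD2)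
qed

text \<open>A robber reaching \<open>W\<close> comes from \<open>W\<close> or from a guard's vertex,
  and in both cases he stood on a cop. Allowing \<open>Q\<close> to meet \<open>W\<close> in
  occupied vertices covers both keeping a set clear and making an occupied one clear.\<close>

lemma escape_disjoint:
  assumes "guarded G p j W" "p ` {..<j} \<subseteq> p ` {..<K}" "Q \<inter> W \<subseteq> p ` {..<K}"
  shows "escape G K p p' Q \<inter> W = {}"
proof (intro equals0I)
  fix u
  assume "u \<in> escape G K p p' Q \<inter> W"
  then obtain v where v: "v \<in> Q" "v \<notin> p ` {..<K}" "v = u \<or> (v, u) \<in> parcs G" "u \<in> W"
    unfolding escape_def by blast
  then have "v \<in> W \<union> p ` {..<j}"
    using assms(1) unfolding guarded_def by blast
  then show False
    using v(1,2) assms(2,3) by blast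
qed

lemma cop_steps_keep_clear:
  assumes "(cop_step G K j)\<^sup>*\<^sup>* x y" "j \<le> K" "guarded G (fst x) j W" "snd x \<inter> W = {}"
  shows "snd y \<inter> W = {}"
  using assms(1,4)
proof (induction rule: rtranclp_induct)
  case (step y z)
  have "guarded G (fst y) j W"
    using guarded_cong[OF cop_steps_guard_set[OF step(1)]] assms(3) by blast
  moreover have "fst y ` {..<j} \<subseteq> fst y ` {..<K}"
    using assms(2) by auto
  ultimately have "escape G K (fst y) (fst z) (snd y) \<inter> W = {}"
    using step.IH step.prems by (intro escape_disjoint) auto
  then show ?case
    using step(2) by (simp add: cop_step_def)
qed auto

text \<open>\<open>escape\<close> discards a position under a cop only in the next round, so one
  idle round turns an occupied region into a clear one.\<close>

lemma cop_step_stay: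
  assumes "j \<le> K" "guarded G p j W" "Q \<inter> W \<subseteq> p ` {..<K}"
  shows "\<exists>Q'. cop_step G K j (p, Q) (p, Q') \<and> Q' \<inter> W = {}"
proof -
  have "p ` {..<j} \<subseteq> p ` {..<K}"
    using assms(1) by auto
  then have "escape G K p p Q \<inter> W = {}"
    using assms(2,3) by (intro escape_disjoint)
  then show ?thesis
    by (auto simp: cop_step_def)
qed

section \<open>Walking cops to prescribed vertices\<close>

lemma walk_one_cop:
  assumes "(p i, v) \<in> (parcs G)\<^sup>*" "j \<le> i"
  shows "\<exists>Q'. (cop_step G K j)\<^sup>*\<^sup>* (p, Q) (p(i := v), Q')"
  using assms(1)
proof (induction rule: rtrancl_induct)
  case base
  then show ?case
    by (metis fun_upd_triv rtranclp.rtrancl_refl)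
next
  case (step u v)
  then obtain Q' where "(cop_step G K j)\<^sup>*\<^sup>* (p, Q) (p(i := u), Q')"
    by blast
  moreover have "cop_step G K j (p(i := u), Q') (p(i := v), escape G K (p(i := u)) (p(i := v)) Q')"
    using step(2) assms(2) by (auto simp: cop_step_def)
  ultimately show ?case
    by (meson rtranclp.rtrancl_into_rtrancl)
qed

lemma walk_cops:
  assumes "\<forall>i\<in>{j..<j + m}. (p i, q i) \<in> (parcs G)\<^sup>*"
  shows "\<exists>Q'. (cop_step G K j)\<^sup>*\<^sup>* (p, Q) (\<lambda>i. if i \<in> {j..<j + m} then q i else p i, Q')"
  using assms
proof (induction m)
  case 0
  then show ?case
    by auto
next
  case (Suc m)
  define p1 where "p1 = (\<lambda>i. if i \<in> {j..<j + m} then q i else p i)"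
  obtain Q1 where Q1: "(cop_step G K j)\<^sup>*\<^sup>* (p, Q) (p1, Q1)"
    using Suc by (auto simp: p1_def)
  have "(p1 (j + m), q (j + m)) \<in> (parcs G)\<^sup>*"
    using Suc.prems by (auto simp: p1_def)
  from walk_one_cop[where p = p1 and i = "j + m", OF this, of j K Q1] obtain Q2 where
    "(cop_step G K j)\<^sup>*\<^sup>* (p1, Q1) (p1(j + m := q (j + m)), Q2)"
    by auto
  moreover have "p1(j + m := q (j + m)) = (\<lambda>i. if i \<in> {j..<j + Suc m} then q i else p i)"
    by (auto simp: p1_def fun_eq_iff)
  ultimately show ?case
    using Q1 by (metis rtranclp_trans)
qed

text \<open>Connectedness lets the cops from number \<open>j\<close> on walk one by one to the
  vertices of \<open>X\<close>, one cop for each. Nothing is claimed about \<open>Q'\<close>: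
  clearing starts from an arbitrary robber set.\<close>

lemma place_cops:
  assumes conn: "\<forall>u\<in>pverts G. \<forall>v\<in>pverts G. (u, v) \<in> (parcs G)\<^sup>*"
    and "X \<subseteq> pverts G" "finite X" "j + card X \<le> K" "\<forall>i<K. p i \<in> pverts G"
  shows "\<exists>p' Q'. (cop_step G K j)\<^sup>*\<^sup>* (p, Q) (p', Q') \<and> p' ` {j..<j + card X} = X \<and>
    (\<forall>i<K. p' i \<in> pverts G)"
proof -
  obtain q where q: "bij_betw q {j..<j + card X} X"
    using finite_same_card_bij[of "{j..<j + card X}" X] assms(3) by auto
  then have "q i \<in> pverts G" if "i \<in> {j..<j + card X}" for i
    using that assms(2) by (auto simp: bij_betw_def)
  moreover obtain Q' where
    "(cop_step G K j)\<^sup>*\<^sup>* (p, Q) (\<lambda>i. if i \<in> {j..<j + card X} then q i else p i, Q')"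
    using walk_cops[of j "card X" p q G K Q] conn assms(4,5) calculation by fastforce
  moreover have "(\<lambda>i. if i \<in> {j..<j + card X} then q i else p i) ` {j..<j + card X} = X"
    using q by (auto simp: bij_betw_def)
  ultimately show ?thesis
    using assms(5) by (intro exI[of _ "\<lambda>i. if i \<in> {j..<j + card X} then q i else p i"] exI[of _ Q']) auto
qed

text \<open>Induction on \<open>card U\<close>: both sides of a separator of a large set are
  strictly smaller. The \<open>j\<close> guards are paid for by the levels below \<open>d\<close>,
  and the separator of \<open>U\<close> by level \<open>d\<close>. The bound
  \<open>Suc (ell n)\<close> admits the sides of a set split at depth \<open>ell n\<close>.\<close>

lemma clear_region:
  assumes G: "pair_graph G"
    and conn: "\<forall>u\<in>pverts G. \<forall>v\<in>pverts G. (u, v) \<in> (parcs G)\<^sup>*"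
    and pos: "f n \<ge> 1"
    and sep: "\<And>U d. U \<subseteq> pverts G \<Longrightarrow> U \<noteq> {} \<Longrightarrow> real (card U) \<le> (2/3) ^ d * real n \<Longrightarrow>
      \<exists>A B X. separation (induce G U) (level_cops f n d) (2/3) A B X"
    and "U \<subseteq> pverts G" "real (card U) \<le> (2/3) ^ d * real n" "d \<le> Suc (ell n)"
    and "j \<le> (\<Sum>i<d. level_cops f n i)" "\<forall>i<C_bound f n. p i \<in> pverts G" "guarded G p j U"
  shows "\<exists>p' Q'. (cop_step G (C_bound f n) j)\<^sup>*\<^sup>* (p, Q) (p', Q') \<and> Q' \<inter> U = {}"
  using assms(5-)
proof (induction "card U" arbitrary: U d j p Q rule: less_induct)
  case less
  interpret pair_graph G by fact
  let ?K = "C_bound f n"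
  have bound: "(\<Sum>i<e. level_cops f n i) + f n \<le> ?K" if "e \<le> Suc (ell n)" for e
  proof -
    have "(\<Sum>i<e. level_cops f n i) \<le> (\<Sum>i=0..ell n. level_cops f n i)"
      using that by (intro sum_mono2) auto
    then show ?thesis
      by (simp add: C_bound_def)
  qed
  have finU: "finite U"
    using less.prems(1) pair_finite_verts by (rule finite_subset)
  show ?case
  proof (cases "card U \<le> f n")
    case True
    then have K: "j + card U \<le> ?K"
      using bound[OF less.prems(3)] less.prems(4) by linarith
    from place_cops[OF conn less.prems(1) finU K less.prems(5), of Q]
    obtain p1 Q1 where 1: "(cop_step G ?K j)\<^sup>*\<^sup>* (p, Q) (p1, Q1)" "p1 ` {j..<j + card U} = U"
      by blast
    have "guarded G p1 j U"
      using guarded_cong[OF cop_steps_guard_set[OF 1(1)], of G U] less.prems(6) by simp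
    \<comment> \<open>Every vertex of \<open>U\<close> is now occupied, so an idle round clears it,
      whatever \<open>Q1\<close> is.\<close>
    moreover have "{j..<j + card U} \<subseteq> {..<?K}"
      using K by auto
    then have "Q1 \<inter> U \<subseteq> p1 ` {..<?K}"
      using 1(2) by blast
    ultimately obtain Q2 where "cop_step G ?K j (p1, Q1) (p1, Q2)" "Q2 \<inter> U = {}"
      using cop_step_stay[of j ?K G p1 U Q1] K by auto
    then show ?thesis
      using 1(1) by (meson rtranclp.rtrancl_into_rtrancl)
  next
    case False
    with pos have "card U \<ge> 2" "U \<noteq> {}"
      by auto
    obtain A B X where S: "separation (induce G U) (level_cops f n d) (2/3) A B X"
      using sep[OF less.prems(1) \<open>U \<noteq> {}\<close> less.prems(2)] by blast
    have UABX: "U = A \<union> B \<union> X" and X: "card X \<le> level_cops f n d"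
      and arcs: "\<And>a b. a \<in> A \<Longrightarrow> b \<in> B \<Longrightarrow> (a, b) \<notin> parcs G \<and> (b, a) \<notin> parcs G"
      and small: "real (card A) \<le> 2/3 * real (card U)" "real (card B) \<le> 2/3 * real (card U)"
      using S by (auto simp: separation_def)
    \<comment> \<open>A set with two vertices cannot be at depth \<open>Suc (ell n)\<close>, so
      \<open>Suc d\<close> is again admissible for the sides.\<close>
    have d: "d \<le> ell n"
      using \<open>card U \<ge> 2\<close> less.prems(2) by (intro depth_le_ell) linarith
    \<comment> \<open>The cops on \<open>X\<close> directly follow the old guards, so they are
      frozen together with them.\<close>
    define j' where "j' = j + card X"
    have j': "j' \<le> (\<Sum>i<Suc d. level_cops f n i)" "j' \<le> ?K" "j \<le> j'"
      using bound[of "Suc d"] d less.prems(4) X by (auto simp: j'_def)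
    have XV: "X \<subseteq> pverts G" "finite X"
      using UABX less.prems(1) finU by auto
    from place_cops[OF conn XV _ less.prems(5), of j Q]
    obtain p1 Q1 where 1: "(cop_step G ?K j)\<^sup>*\<^sup>* (p, Q) (p1, Q1)" "p1 ` {j..<j'} = X"
      "\<forall>i<?K. p1 i \<in> pverts G"
      using j'(2) unfolding j'_def by blast
    have "p1 ` {..<j'} = p1 ` {..<j} \<union> p1 ` {j..<j'}"
      using j'(3) by (metis image_Un ivl_disj_un_one(2))
    then have guards: "p1 ` {..<j'} = p ` {..<j} \<union> X"
      using cop_steps_guard_set[OF 1(1)] 1(2) by simp
    \<comment> \<open>A neighbour of \<open>A\<close> inside \<open>U\<close> lies in
      \<open>A\<close> or \<open>X\<close>; one outside \<open>U\<close> is held by an old guard.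
      The same holds for \<open>B\<close>.\<close>
    have gA: "guarded G p1 j' A" and gB: "guarded G p1 j' B" and gU: "guarded G p1 j' U"
      using less.prems(6) arcs unfolding guarded_def guards UABX by blast+
    have "A \<subseteq> pverts G" "B \<subseteq> pverts G" "card A < card U" "card B < card U" "Suc d \<le> Suc (ell n)"
      using UABX less.prems(1) small \<open>card U \<ge> 2\<close> d by auto
    note IH = less.hyps[OF this(3) this(1) separation_sides(1)[OF S less.prems(2)] this(5) j'(1)]
      less.hyps[OF this(4) this(2) separation_sides(2)[OF S less.prems(2)] this(5) j'(1)]
    from IH(1)[OF 1(3) gA] obtain p2 Q2 where
      2: "(cop_step G ?K j')\<^sup>*\<^sup>* (p1, Q1) (p2, Q2)" "Q2 \<inter> A = {}"
      by blast
    have p2: "p2 ` {..<j'} = p1 ` {..<j'}"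
      using cop_steps_guard_set[OF 2(1)] by simp
    have "\<forall>i<?K. p2 i \<in> pverts G"
      using cop_steps_valid[OF 2(1) G] 1(3) by simp
    moreover have "guarded G p2 j' B"
      using guarded_cong[OF p2] gB by blast
    ultimately obtain p3 Q3 where 3: "(cop_step G ?K j')\<^sup>*\<^sup>* (p2, Q2) (p3, Q3)" "Q3 \<inter> B = {}"
      using IH(2) by blast
    have p3: "p3 ` {..<j'} = p1 ` {..<j'}"
      using cop_steps_guard_set[OF 3(1)] p2 by simp
    \<comment> \<open>The guards of \<open>A\<close> stood still while \<open>B\<close> was cleared.
      Then \<open>U\<close> can contain a robber only on \<open>X\<close>, which is occupied, and an
      idle round removes him.\<close>
    have "Q3 \<inter> A = {}"
      using cop_steps_keep_clear[OF 3(1) j'(2), of A] 2(2) gA guarded_cong[OF p2] by auto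
    moreover have "X \<subseteq> p3 ` {..<?K}"
      using guards p3 j'(2) by (metis Un_upper2 image_mono lessThan_subset_iff order_trans)
    ultimately have "Q3 \<inter> U \<subseteq> p3 ` {..<?K}"
      using 3(2) UABX by auto
    moreover have "guarded G p3 j' U"
      using guarded_cong[OF p3] gU by blast
    ultimately obtain Q4 where 4: "cop_step G ?K j' (p3, Q3) (p3, Q4)" "Q4 \<inter> U = {}"
      using cop_step_stay[OF j'(2)] by blast
    have "(cop_step G ?K j')\<^sup>*\<^sup>* (p1, Q1) (p3, Q4)"
      using 2(1) 3(1) 4(1) by auto
    then have "(cop_step G ?K j)\<^sup>*\<^sup>* (p, Q) (p3, Q4)"
      using 1(1) cop_steps_mono[OF _ j'(3)] by (meson rtranclp_trans)
    then show ?thesis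
      using 4(2) by blast
  qed
qed

text \<open>The chain of states is read as a schedule. An uncaught robber would remain in the second
  component of every state, but the last one contains no vertex.\<close>

lemma cops_win_if_cleared:
  assumes "(cop_step G K 0)\<^sup>*\<^sup>* (p, Q) (p', Q')" "Q' \<inter> pverts G = {}" "pverts G \<subseteq> Q"
    and "pair_graph G" "\<forall>i<K. p i \<in> pverts G"
  shows "cops_win G K"
proof -
  obtain N s where s: "s 0 = (p, Q)" "s N = (p', Q')"
    "\<And>t. t < N \<Longrightarrow> cop_step G K 0 (s t) (s (Suc t))"
    using rtranclp_imp_relpowp[OF assms(1)] unfolding relpowp_fun_conv by metis
  \<comment> \<open>A schedule is infinite, so the cops stand still after round
    \<open>N\<close>.\<close>
  define c where "c i t = fst (s (min t N)) i" for i t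
  have reach: "(cop_step G K 0)\<^sup>*\<^sup>* (p, Q) (s t)" if "t \<le> N" for t
    using that
  proof (induction t)
    case (Suc t)
    then show ?case
      using s(3)[of t] by (auto intro: rtranclp.rtrancl_into_rtrancl)
  qed (simp add: s(1))
  have "lazy_walk G (c i)" if "i < K" for i
    unfolding lazy_walk_def
  proof (intro allI conjI)
    fix t
    show "c i t \<in> pverts G"
      using cop_steps_valid[OF reach assms(4), of "min t N"] assms(5) that by (simp add: c_def)
    show "c i (Suc t) = c i t \<or> (c i t, c i (Suc t)) \<in> parcs G"
    proof (cases "t < N")
      case True
      then show ?thesis
        using s(3)[OF True] that by (auto simp: c_def cop_step_def min_def Suc_le_eq)
    qed (auto simp: c_def min_def)
  qed
  moreover have "\<exists>t. \<exists>i<K. c i t = r t \<or> c i (Suc t) = r t" if r: "lazy_walk G r" for r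
  proof (rule ccontr)
    assume free: "\<nexists>t. \<exists>i<K. c i t = r t \<or> c i (Suc t) = r t"
    have "r t \<in> snd (s t)" if "t \<le> N" for t
      using that
    proof (induction t)
      case 0
      then show ?case
        using r assms(3) by (auto simp: s(1) lazy_walk_def)
    next
      case (Suc t)
      have "c i t \<noteq> r t" "c i (Suc t) \<noteq> r t" if "i < K" for i
        using free that by blast+
      moreover have "c i t = fst (s t) i" "c i (Suc t) = fst (s (Suc t)) i" for i
        using Suc.prems by (simp_all add: c_def min_absorb1)
      \<comment> \<open>The two exclusions in \<open>escape\<close>, cops before and after their
        move, are exactly the two ways of being caught in \<open>cops_win\<close>.\<close>
      ultimately have "r t \<notin> fst (s t) ` {..<K}" "r t \<notin> fst (s (Suc t)) ` {..<K}"
        by (metis imageE lessThan_iff)+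
      moreover have "r (Suc t) = r t \<or> (r t, r (Suc t)) \<in> parcs G"
        using r by (auto simp: lazy_walk_def)
      moreover have "snd (s (Suc t)) = escape G K (fst (s t)) (fst (s (Suc t))) (snd (s t))"
        using s(3)[of t] Suc.prems by (auto simp: cop_step_def)
      ultimately show ?case
        using Suc.IH Suc.prems unfolding escape_def by auto
    qed
    from this[of N] show False
      using s(2) r assms(2) by (auto simp: lazy_walk_def)
  qed
  ultimately show ?thesis
    unfolding cops_win_def by (intro exI[of _ c]) blast
qed

section \<open>The bounds for connected graphs and for STT\<close>

lemma connected_imp_rtrancl:
  assumes "pair_graph G" "Digraph_Component.connected (with_proj G)"
  shows "\<forall>u\<in>pverts G. \<forall>v\<in>pverts G. (u, v) \<in> (parcs G)\<^sup>*" "pverts G \<noteq> {}"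
proof -
  interpret pair_graph G by fact
  \<comment> \<open>The library notion \<open>connected\<close> is strong connectedness of the
    symmetric closure, which here has the same arcs.\<close>
  have "parcs (mk_symmetric (with_proj G)) = parcs G"
    using adj_mk_symmetric_eq[OF sym_arcs] by simp
  then show "\<forall>u\<in>pverts G. \<forall>v\<in>pverts G. (u, v) \<in> (parcs G)\<^sup>*" "pverts G \<noteq> {}"
    using assms(2) reachable_rtranclI[of "with_proj (mk_symmetric (with_proj G))"]
    unfolding connected_def strongly_connected_def by auto
qed

lemma cop0_le:
  fixes G :: "'a pair_pre_digraph"
  assumes G: "pair_graph G" "Digraph_Component.connected (with_proj G)"
    and pos: "f (card (pverts G)) \<ge> 1"
    and sep: "\<And>U d. U \<subseteq> pverts G \<Longrightarrow> U \<noteq> {} \<Longrightarrow>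
      real (card U) \<le> (2/3) ^ d * real (card (pverts G)) \<Longrightarrow>
      \<exists>A B X. separation (induce G U) (level_cops f (card (pverts G)) d) (2/3) A B X"
  shows "cop0 G \<le> C_bound f (card (pverts G))"
proof -
  interpret pair_graph G by fact
  note conn = connected_imp_rtrancl[OF G]
  then obtain v where v: "v \<in> pverts G"
    by blast
  \<comment> \<open>No arc enters the full vertex set from outside, so the recursion starts at depth
    0 without guards, all cops on one vertex.\<close>
  have "guarded G (\<lambda>_. v) 0 (pverts G)"
    by (auto simp: guarded_def dest: in_arcsD1)
  then obtain p' Q' where
    "(cop_step G (C_bound f (card (pverts G))) 0)\<^sup>*\<^sup>* (\<lambda>_. v, pverts G) (p', Q')"
    "Q' \<inter> pverts G = {}"
    using clear_region[where U = "pverts G" and d = 0 and j = 0 and p = "\<lambda>_. v" and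
          Q = "pverts G", OF G(1) conn(1) pos sep] v by auto
  then have "cops_win G (C_bound f (card (pverts G)))"
    using cops_win_if_cleared[OF _ _ _ G(1)] v by blast
  then show ?thesis
    unfolding cop0_def by (rule Least_le)
qed

text \<open>For non-monotone \<open>f\<close>, a separator of size \<open>f (card U)\<close> may
  exceed the summand of its depth; monotonicity of \<open>f\<close> or separators within the
  separation number exclude this. Connectedness enters through the walks of the cops.\<close>

theorem theorem2:
  fixes \<C> :: "'a pair_pre_digraph set" and f :: "nat \<Rightarrow> nat"
  assumes graphs: "\<forall>G\<in>\<C>. pair_graph G"
    and hered: "hereditary \<C>"
    and sep: "separable f \<C>"
    and pos: "\<forall>m\<ge>1. f m \<ge> 1"
  shows
    "(\<exists>S. separation_algorithm (\<lambda>H. f (card (pverts H))) \<C> S \<and>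
        (\<forall>G\<in>\<C>. pverts G \<noteq> {} \<longrightarrow> stt_cops S f G \<le> enat (C_bound f (card (pverts G))))) \<and>
     (\<forall>S. (mono_on {1..} f \<and> separation_algorithm (\<lambda>H. f (card (pverts H))) \<C> S
           \<or> separation_algorithm separation_number \<C> S) \<longrightarrow>
        (\<forall>G\<in>\<C>. pverts G \<noteq> {} \<longrightarrow> stt_cops S f G \<le> enat (C_bound f (card (pverts G))))) \<and>
     (\<forall>G\<in>\<C>. Digraph_Component.connected (with_proj G) \<longrightarrow>
        cop0 G \<le> C_bound f (card (pverts G)))"
proof -
  have pos': "f (card (pverts G)) \<ge> 1" if "G \<in> \<C>" "pverts G \<noteq> {}" for G
  proof -
    interpret pair_graph G using graphs that by blast
    show ?thesis
      using pos that pair_finite_verts by (simp add: Suc_le_eq card_gt_0_iff)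
  qed
  note level = separation_number_level[OF hered sep]
  note induced = hereditary_induce[OF hered]
  have optimal: "stt_cops S f G \<le> enat (C_bound f (card (pverts G)))"
    if "separation_algorithm separation_number \<C> S" "G \<in> \<C>" "pverts G \<noteq> {}" for S G
  proof (rule stt_cops_le[where S = S])
    fix U d A B X
    assume U: "U \<subseteq> pverts G" "U \<noteq> {}" "real (card U) \<le> (2/3) ^ d * real (card (pverts G))"
      and S: "S (induce G U) = (A, B, X)"
    have G: "pair_graph G"
      using graphs that by blast
    have "separation (induce G U) (separation_number (induce G U)) (2/3) A B X"
      using that(1) induced[OF that(2) G U(1,2)] U(2) S by (force simp: separation_algorithm_def)
    then show "separation (induce G U) (level_cops f (card (pverts G)) d) (2/3) A B X"
      using level[OF that(2) G U] by (rule separation_mono)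
  qed (use pos' that in auto)
  have mono: "stt_cops S f G \<le> enat (C_bound f (card (pverts G)))"
    if f: "mono_on {1..} f" and alg: "separation_algorithm (\<lambda>H. f (card (pverts H))) \<C> S"
      and "G \<in> \<C>" "pverts G \<noteq> {}" for S G
  proof (rule stt_cops_le[where S = S])
    fix U d A B X
    assume U: "U \<subseteq> pverts G" "U \<noteq> {}" "real (card U) \<le> (2/3) ^ d * real (card (pverts G))"
      and S: "S (induce G U) = (A, B, X)"
    interpret pair_graph G
      using graphs that by blast
    \<comment> \<open>Both arguments of \<open>f\<close> compared below are thus positive, where
      \<open>f\<close> is monotone.\<close>
    have "card U \<ge> 1"
      using U pair_finite_verts by (simp add: Suc_le_eq card_gt_0_iff finite_subset)
    moreover have "card U \<le> nat \<lfloor>(2/3) ^ d * real (card (pverts G))\<rfloor>"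
      using U(3) by (rule le_nat_floor)
    ultimately have "f (card U) \<le> level_cops f (card (pverts G)) d"
      using f by (intro mono_onD[OF f]) auto
    moreover have "separation (induce G U) (f (card U)) (2/3) A B X"
      using alg induced[OF that(3) pair_graph U(1,2)] U(2) S by (force simp: separation_algorithm_def)
    ultimately show "separation (induce G U) (level_cops f (card (pverts G)) d) (2/3) A B X"
      by (rule separation_mono[rotated])
  qed (use pos' that in auto)
  \<comment> \<open>Choosing separators within the separation number gives the witness for the first
    claim; separability makes them obey the bound \<open>f\<close> as well.\<close>
  have "\<forall>H\<in>\<C>. \<exists>T. case T of (A, B, X) \<Rightarrow> separation H (separation_number H) (2/3) A B X"
    using graphs exists_separation by fastforce
  then obtain S where
    "\<forall>H\<in>\<C>. case S H of (A, B, X) \<Rightarrow> separation H (separation_number H) (2/3) A B X"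
    by metis
  then have S: "separation_algorithm separation_number \<C> S"
    by (auto simp: separation_algorithm_def)
  then have "separation_algorithm (\<lambda>H. f (card (pverts H))) \<C> S"
    using sep unfolding separation_algorithm_def separable_def
    by (fastforce intro: separation_mono)
  moreover have "cop0 G \<le> C_bound f (card (pverts G))"
    if G: "G \<in> \<C>" "Digraph_Component.connected (with_proj G)" for G
  proof (rule cop0_le)
    show graph: "pair_graph G"
      using graphs G by blast
    show "f (card (pverts G)) \<ge> 1"
      using pos' G connected_imp_rtrancl(2)[OF graph] by blast
    show "\<exists>A B X. separation (induce G U) (level_cops f (card (pverts G)) d) (2/3) A B X"
      if U: "U \<subseteq> pverts G" "U \<noteq> {}" "real (card U) \<le> (2/3) ^ d * real (card (pverts G))" for U d
      using exists_separation[OF pair_graph_induce[OF graph U(1)]] level[OF G(1) graph U]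
        separation_mono by blast
  qed (use G in auto)
  ultimately show ?thesis
    using optimal mono S by blast
qed

end
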